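(* There always exist infinitely many integers $n\ge1$ such that $n$ and $n+2$ are simultaneously $\mathscr{B}$-free. If $2\notin\mathscr{B}$, there exist infinitely many integers $n\ge1$ such that $n$ and $n+1$ are simultaneously $\mathscr{B}$-free.
   Context: $\mathscr{B}=\{b_k:k\ge1\}\subset\{2,3,4,\ldots\}$ is a given infinite set of pairwise relatively prime integers with $\sum_{k\ge1}1/b_k<\infty$. A positive integer is called $\mathscr{B}$-free if it is not divisible by any $b_k$, $k\ge1$. *)

theory Defs
  imports "HOL-Analysis.Infinite_Sum"
begin

definition B_free :: "nat set \<Rightarrow> nat \<Rightarrow> bool" where
  "B_free B n \<longleftrightarrow> n \<ge> 1 \<and> (\<forall>b\<in>B. \<not> b dvd n)"

end

theory Submission
  imports Defs "HOL-Number_Theory.Cong"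
begin

text \<open>
  Call a shift \<open>h\<close> admissible if every \<open>b \<in> B\<close> leaves some residue \<open>r\<close> with \<open>r\<close> and \<open>r + h\<close> both
  nonzero modulo \<open>b\<close>. The Chinese remainder theorem handles the members of \<open>B\<close> in a large finite
  set \<open>F\<close> with product \<open>W\<close> by restricting to a progression \<open>n = a + W m\<close>, \<open>1 \<le> m \<le> M\<close>. A remaining
  \<open>b\<close> is coprime to \<open>W\<close>, so it kills at most \<open>2 (M div b + 1)\<close> values of \<open>m\<close>: this is at most
  \<open>4 M / b\<close> if \<open>b \<le> M\<close>, and at most \<open>2 \<le> 2 C M / b\<close> if \<open>M < b \<le> C M\<close>, where \<open>n + h \<le> C M\<close>. The tail
  of \<open>\<Sum> 1/b\<close> outside \<open>F\<close> is small, and the tail beyond \<open>M\<close> beats the constant \<open>C\<close> once \<open>M\<close> is large,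
  so at least half of the \<open>m\<close> survive.
\<close>

text \<open>\<open>F\<close> is chosen with sum within \<open>e\<close> of the total. Adding a
  finite \<open>G\<close> disjoint from \<open>F\<close> cannot exceed the total, since all terms
  are nonnegative.\<close>

lemma summable_on_nonneg_tail:
  fixes f :: "'a \<Rightarrow> real"
  assumes "f summable_on A" and "\<And>x. x \<in> A \<Longrightarrow> 0 \<le> f x" and "0 < e"
  obtains F where "finite F" "F \<subseteq> A"
    "\<And>G. finite G \<Longrightarrow> G \<subseteq> A \<Longrightarrow> G \<inter> F = {} \<Longrightarrow> sum f G \<le> e"
proof -
  obtain F where F: "finite F" "F \<subseteq> A" "dist (sum f F) (infsum f A) \<le> e"
    using infsum_finite_approximation[OF assms(1,3)] by blast
  have "sum f G \<le> e" if G: "finite G" "G \<subseteq> A" "G \<inter> F = {}" for G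
  proof -
    have "sum f G + sum f F = sum f (G \<union> F)"
      using G F by (simp add: sum.union_disjoint)
    also have "\<dots> \<le> infsum f A"
      using G F assms by (intro finite_sum_le_infsum) auto
    finally show ?thesis
      using F(3) by (simp add: dist_real_def)
  qed
  with F show ?thesis
    by (intro that) auto
qed

text \<open>As \<open>W\<close> is invertible modulo \<open>b\<close>, all solutions are congruent
  modulo \<open>b\<close>, so each value of \<open>m div b\<close> occurs at most once; the values
  run from 0 to \<open>M div b\<close>.\<close>

lemma card_dvd_progression_le:
  fixes a b W M :: nat
  assumes "coprime b W"
  shows "card {m \<in> {1..M}. b dvd a + W * m} \<le> M div b + 1"
proof -
  let ?S = "{m \<in> {1..M}. b dvd a + W * m}"
  have "inj_on (\<lambda>m. m div b) ?S"
  proof (rule inj_onI)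
    fix x y assume xy: "x \<in> ?S" "y \<in> ?S" "x div b = y div b"
    then have "[a + W * x = a + W * y] (mod b)"
      by (simp add: cong_def)
    then have "[x = y] (mod b)"
      using assms by (simp add: cong_add_lcancel_nat cong_mult_lcancel_nat coprime_commute)
    with xy(3) show "x = y"
      by (metis cong_def div_mult_mod_eq)
  qed
  moreover have "(\<lambda>m. m div b) ` ?S \<subseteq> {0..M div b}"
    by (auto intro: div_le_mono)
  ultimately have "card ?S \<le> card {0..M div b}"
    by (intro card_inj_on_le) auto
  then show ?thesis by simp
qed

lemma infinite_nat_if_card_ge_half:
  fixes S :: "nat set"
  assumes "\<And>M. N \<le> M \<Longrightarrow> real M / 2 \<le> real (card (S \<inter> {1..M}))"
  shows "infinite S"
proof
  assume "finite S"
  define M where "M = max N (2 * card S + 1)"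
  have "card (S \<inter> {1..M}) \<le> card S"
    using \<open>finite S\<close> by (intro card_mono) auto
  moreover have "2 * card S + 1 \<le> M" "real M / 2 \<le> real (card (S \<inter> {1..M}))"
    using assms[of M] by (auto simp: M_def)
  ultimately show False by linarith
qed

lemma infinite_B_free_shift:
  fixes B :: "nat set"
  assumes B: "B \<subseteq> {2..}" "pairwise coprime B" "(\<lambda>b. 1 / real b) summable_on B"
    and res: "\<And>b. b \<in> B \<Longrightarrow> \<exists>r. \<not> b dvd r \<and> \<not> b dvd r + h"
  shows "infinite {n. n \<ge> 1 \<and> B_free B n \<and> B_free B (n + h)}"
proof -
  let ?f = "\<lambda>b::nat. 1 / real b"
  \<comment> \<open>The tolerance 1/16 makes the later bound \<open>4 * real M * sum ?f G1\<close>
    at most M/4.\<close>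
  obtain F where F: "finite F" "F \<subseteq> B"
    and tailF: "\<And>G. finite G \<Longrightarrow> G \<subseteq> B \<Longrightarrow> G \<inter> F = {} \<Longrightarrow> sum ?f G \<le> 1/16"
    by (rule summable_on_nonneg_tail[OF B(3), of "1/16"]) auto
  define W where "W = \<Prod>F"
  obtain u where u: "\<And>b. b \<in> B \<Longrightarrow> \<not> b dvd u b \<and> \<not> b dvd u b + h"
    using res by metis
  have "\<forall>i\<in>F. \<forall>j\<in>F. i \<noteq> j \<longrightarrow> coprime i j"
    using B(2) F(2) by (auto simp: pairwise_def)
  then obtain a where a: "\<forall>b\<in>F. [a = u b] (mod b)"
    using chinese_remainder_nat[OF F(1), of "\<lambda>b. b" u] by auto
  have W: "W \<ge> 1"
    using F B(1) unfolding W_def by (intro prod_ge_1) auto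
  \<comment> \<open>\<open>b\<close> divides \<open>W\<close>, so the whole progression keeps the
    admissible residue \<open>u b\<close> modulo \<open>b\<close>.\<close>
  have freeF: "\<not> b dvd a + W * m \<and> \<not> b dvd a + h + W * m" if "b \<in> F" for b m
  proof -
    have "b dvd W * m"
      unfolding W_def using F(1) that by (intro dvd_mult2 dvd_prodI) auto
    then show ?thesis
      using a u[of b] that F(2)
      by (metis cong_add_rcancel_nat cong_dvd_iff dvd_add_left_iff subsetD)
  qed
  have copW: "coprime b W" if "b \<in> B - F" for b
    unfolding W_def
  proof (rule prod_coprime_right)
    fix c assume "c \<in> F"
    then have "b \<in> B" "c \<in> B" "b \<noteq> c"
      using that F(2) by auto
    then show "coprime b c"
      using B(2) by (simp add: pairwise_def)
  qed
  define C where "C = a + h + W"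
  have C: "C \<ge> 1" using W by (simp add: C_def)
  \<comment> \<open>A second tail is needed because \<open>C\<close> depends on \<open>F\<close>.
    Its tolerance makes \<open>2 * real (C * M) * sum ?f G2\<close> at most M/4.\<close>
  obtain F' where F': "finite F'" "F' \<subseteq> B"
    and tailF': "\<And>G. finite G \<Longrightarrow> G \<subseteq> B \<Longrightarrow> G \<inter> F' = {} \<Longrightarrow> sum ?f G \<le> 1 / (8 * real C)"
    by (rule summable_on_nonneg_tail[OF B(3), of "1 / (8 * real C)"]) (use C in auto)
  define good where
    "good = {m. m \<ge> 1 \<and> B_free B (a + W * m) \<and> B_free B (a + h + W * m)}"
  \<comment> \<open>For \<open>N \<le> M\<close> every element of \<open>F'\<close> lies below
    \<open>M\<close>, so the moduli above \<open>M\<close> avoid \<open>F'\<close>. Inserting 0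
    keeps \<open>Max\<close> defined when \<open>F'\<close> is empty and forces
    \<open>M \<ge> 1\<close>.\<close>
  define N where "N = Suc (Max (insert 0 F'))"
  have half: "real M / 2 \<le> real (card (good \<inter> {1..M}))" if "N \<le> M" for M
  proof -
    have less_M: "b < M" if "b \<in> insert 0 F'" for b
      using Max_ge[OF _ that] F'(1) \<open>N \<le> M\<close> by (simp add: N_def)
    have M: "M \<ge> 1"
      using less_M[of 0] by simp
    define bad where "bad b = {m \<in> {1..M}. b dvd a + W * m} \<union> {m \<in> {1..M}. b dvd a + h + W * m}"
      for b
    define G1 where "G1 = {b \<in> B - F. b \<le> M}"
    define G2 where "G2 = {b \<in> B - F. M < b \<and> b \<le> C * M}"
    have fin: "finite G1" "finite G2"
      unfolding G1_def G2_def by (auto intro: finite_subset[of _ "{..M}"] finite_subset[of _ "{..C * M}"])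
    have bad_card: "card (bad b) \<le> 2 * (M div b + 1)" if "b \<in> B - F" for b
      unfolding bad_def mult_2
      by (intro order.trans[OF card_Un_le add_mono] card_dvd_progression_le copW that)
    have bad1: "real (card (bad b)) \<le> 4 * real M * ?f b" if "b \<in> G1" for b
    proof -
      have b: "b \<in> B - F" "b \<le> M" "b > 0" using that B(1) by (auto simp: G1_def)
      have "real (card (bad b)) \<le> 2 * (real (M div b) + 1)"
        using of_nat_mono[OF bad_card[OF b(1)], where 'a=real] by simp
      also have "\<dots> \<le> 2 * (real M / real b + real M / real b)"
        using b of_nat_div_le_of_nat[of M b] by (intro mult_left_mono add_mono) auto
      finally show ?thesis by simp
    qed
    have bad2: "real (card (bad b)) \<le> 2 * real (C * M) * ?f b" if "b \<in> G2" for b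
    proof -
      have b: "b \<in> B - F" "M < b" "b \<le> C * M" using that by (auto simp: G2_def)
      \<comment> \<open>Here \<open>M div b\<close> is 0 because \<open>M < b\<close>.\<close>
      have "real (card (bad b)) \<le> 2 * 1"
        using bad_card[OF b(1)] b(2) by simp
      also have "\<dots> \<le> 2 * (real (C * M) / real b)"
        using b M by (intro mult_left_mono) (auto simp: le_divide_eq simp flip: of_nat_mult)
      finally show ?thesis by simp
    qed
    \<comment> \<open>A divisor of a positive number bounded by \<open>C * M\<close> is itself at
      most \<open>C * M\<close>, so \<open>G1\<close> and \<open>G2\<close> contain every modulus
      outside \<open>F\<close> that can matter.\<close>
    have cover: "{1..M} \<subseteq> (good \<inter> {1..M}) \<union> (\<Union>b\<in>G1. bad b) \<union> (\<Union>b\<in>G2. bad b)"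
    proof
      fix m assume m: "m \<in> {1..M}"
      have le: "a + h + W * m \<le> C * M"
      proof -
        have "a + h \<le> (a + h) * M" "W * m \<le> W * M" using M m by simp_all
        then show ?thesis unfolding C_def add_mult_distrib[of _ W] by (rule add_mono)
      qed
      have pos: "a + W * m \<ge> 1" "a + h + W * m \<ge> 1"
        using W m by (auto simp: Suc_le_eq)
      show "m \<in> (good \<inter> {1..M}) \<union> (\<Union>b\<in>G1. bad b) \<union> (\<Union>b\<in>G2. bad b)"
      proof (cases "m \<in> good")
        case False
        then obtain b where b: "b \<in> B" "b dvd a + W * m \<or> b dvd a + h + W * m"
          using m pos by (auto simp: good_def B_free_def)
        then have "b \<notin> F" using freeF by blast
        moreover have "b \<le> C * M"
          using b(2) pos le by (auto dest!: dvd_imp_le)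
        ultimately have "b \<in> G1 \<union> G2" "m \<in> bad b"
          using b m by (auto simp: G1_def G2_def bad_def)
        then show ?thesis by blast
      qed (use m in auto)
    qed
    have "finite (bad b)" for b by (simp add: bad_def)
    then have "M \<le> card ((good \<inter> {1..M}) \<union> (\<Union>b\<in>G1. bad b) \<union> (\<Union>b\<in>G2. bad b))"
      using card_mono[OF _ cover] fin by auto
    also have "\<dots> \<le> card (good \<inter> {1..M}) + card (\<Union>b\<in>G1. bad b) + card (\<Union>b\<in>G2. bad b)"
      by (intro order.trans[OF card_Un_le] add_mono card_Un_le order_refl)
    also have "\<dots> \<le> card (good \<inter> {1..M}) + (\<Sum>b\<in>G1. card (bad b)) + (\<Sum>b\<in>G2. card (bad b))"
      by (intro add_mono card_UN_le fin order_refl)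
    finally have "real M \<le> real (card (good \<inter> {1..M}))
        + (\<Sum>b\<in>G1. real (card (bad b))) + (\<Sum>b\<in>G2. real (card (bad b)))"
      by (simp flip: of_nat_sum of_nat_add)
    also have "(\<Sum>b\<in>G1. real (card (bad b))) \<le> 4 * real M * sum ?f G1"
      unfolding sum_distrib_left by (intro sum_mono bad1)
    also have "\<dots> \<le> 4 * real M * (1/16)"
      using fin by (intro mult_left_mono tailF) (auto simp: G1_def)
    also have "(\<Sum>b\<in>G2. real (card (bad b))) \<le> 2 * real (C * M) * sum ?f G2"
      unfolding sum_distrib_left by (intro sum_mono bad2)
    also have "\<dots> \<le> 2 * real (C * M) * (1 / (8 * real C))"
      using fin less_M by (intro mult_left_mono tailF') (auto simp: G2_def dest: less_asym)
    \<comment> \<open>Each of the two groups removes at most M/4.\<close>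
    finally show ?thesis using C by (simp add: field_simps)
  qed
  have "infinite good"
    by (rule infinite_nat_if_card_ge_half[OF half])
  moreover have "inj_on (\<lambda>m. a + W * m) good"
    using W by (auto intro: inj_onI)
  ultimately have "infinite ((\<lambda>m. a + W * m) ` good)"
    by (simp add: finite_image_iff)
  moreover have "(\<lambda>m. a + W * m) ` good \<subseteq> {n. n \<ge> 1 \<and> B_free B n \<and> B_free B (n + h)}"
    by (auto simp: good_def B_free_def add_ac)
  ultimately show ?thesis
    using finite_subset by blast
qed

theorem corollary4p3:
  fixes B :: "nat set"
  assumes "B \<subseteq> {2..}"
    and "infinite B"
    and "pairwise coprime B"
    and "(\<lambda>b. 1 / real b) summable_on B"
  shows "infinite {n::nat. n \<ge> 1 \<and> B_free B n \<and> B_free B (n + 2)} \<and>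
    (2 \<notin> B \<longrightarrow> infinite {n::nat. n \<ge> 1 \<and> B_free B n \<and> B_free B (n + 1)})"
proof (intro conjI impI)
  have "\<exists>r. \<not> b dvd r \<and> \<not> b dvd r + 2" if "b \<in> B" for b
  \<comment> \<open>The witness 1 fails only for 3, which divides 1 + 2; there 2 and 4 serve
    instead.\<close>
  proof (cases "b = 3")
    case True
    then show ?thesis by (intro exI[of _ 2]) auto
  next
    case False
    have "b = 2 \<or> b > 3" using that assms(1) False by force
    then show ?thesis
    proof
      assume "b = 2"
      then show ?thesis by (intro exI[of _ 1]) simp
    next
      assume "b > 3"
      then show ?thesis by (intro exI[of _ 1]) (auto dest!: dvd_imp_le)
    qed
  qed
  then show "infinite {n. n \<ge> 1 \<and> B_free B n \<and> B_free B (n + 2)}"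
    by (rule infinite_B_free_shift[OF assms(1,3,4)])
next
  assume "2 \<notin> B"
  have "\<exists>r. \<not> b dvd r \<and> \<not> b dvd r + 1" if "b \<in> B" for b
  proof -
    \<comment> \<open>With 2 excluded, both 1 and 1 + 1 lie strictly below \<open>b\<close>.\<close>
    have "b > 2" using that assms(1) \<open>2 \<notin> B\<close> by (metis atLeast_iff le_neq_implies_less subsetD)
    then show ?thesis by (intro exI[of _ 1]) (auto dest!: dvd_imp_le)
  qed
  then show "infinite {n. n \<ge> 1 \<and> B_free B n \<and> B_free B (n + 1)}"
    by (rule infinite_B_free_shift[OF assms(1,3,4)])
qed

end
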